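(* Let $N\ge 1$ and let $\Re_0$ be a finite family of polytopes in $\mathbb{R}^N$, with set of extreme points $E=\bigcup_{\Omega\in\Re_0}\mathrm{ext}(\Omega)$ of cardinality $R=\mathrm{card}(E)$, and let $r_{\min}:=\min_{\Omega\in\Re_0}\mathrm{card}(\Omega\cap E)\in\{1,\ldots,R\}$. Assume: (H1) for every $x\in E$, $x\notin\mathrm{conv}(E\setminus\{x\})$; (H2) $\Re_0$ contains all $r_{\min}$-polytopes, i.e. $\mathrm{conv}(A)\in\Re_0$ for every subset $A\subset E$ with $\mathrm{card}(A)=r_{\min}$. Define $\Re_{n+1}:=\mathcal{F}(\Re_n)$ for $n\ge 0$. Then $\Re_1=\Re_3$ (equality of sets of polytopes).
   Context: A polytope is a nonempty convex compact subset of $\mathbb{R}^N$ with finitely many extreme points; $\mathrm{ext}(\Omega)$ is the set of extreme points of $\Omega$. Families of polytopes are nonempty. $S$ is the unit sphere of $\mathbb{R}^N$. For a polytope $\Omega$ and $d\in S$, set $E(\Omega,d):=\{x\in\mathrm{ext}(\Omega):\langle x,d\rangle=\max_{z\in\Omega}\langle z,d\rangle\}$. For a finite family $\Re$ of polytopes, the dual family is $$\mathcal{F}(\Re):=\Big\{\mathrm{conv}\Big(\bigcup_{\Omega\in\Re}E(\Omega,d)\Big): d\in S\Big\},$$ which is again a finite family of polytopes. *)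

theory Defs
  imports "HOL-Analysis.Analysis"
begin

definition extreme_points :: "'a::real_vector set \<Rightarrow> 'a set" where
  "extreme_points \<Omega> = {x. x extreme_point_of \<Omega>}"

(* Polytopes here are nonempty, whereas the library's polytope admits the empty set.
   The lemma below gives the intrinsic description in terms of extreme points. *)
definition nonempty_polytope :: "'a::euclidean_space set \<Rightarrow> bool" where
  "nonempty_polytope \<Omega> \<longleftrightarrow> polytope \<Omega> \<and> \<Omega> \<noteq> {}"

lemma nonempty_polytope_iff:
  "nonempty_polytope \<Omega> \<longleftrightarrow>
     \<Omega> \<noteq> {} \<and> convex \<Omega> \<and> compact \<Omega> \<and> finite (extreme_points \<Omega>)"
proof
  assume "nonempty_polytope \<Omega>"
  then obtain v where v: "finite v" "\<Omega> = convex hull v" and ne: "\<Omega> \<noteq> {}"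
    unfolding nonempty_polytope_def polytope_def by blast
  have "extreme_points \<Omega> \<subseteq> v"
    unfolding extreme_points_def v(2) by (rule extreme_points_of_convex_hull)
  then show "\<Omega> \<noteq> {} \<and> convex \<Omega> \<and> compact \<Omega> \<and> finite (extreme_points \<Omega>)"
    using v ne by (auto intro: finite_subset finite_imp_compact_convex_hull)
next
  assume r: "\<Omega> \<noteq> {} \<and> convex \<Omega> \<and> compact \<Omega> \<and> finite (extreme_points \<Omega>)"
  then have "\<Omega> = convex hull (extreme_points \<Omega>)"
    unfolding extreme_points_def using Krein_Milman_Minkowski by blast
  with r show "nonempty_polytope \<Omega>"
    unfolding nonempty_polytope_def polytope_def by blast
qed

(* The extreme points of \<Omega> (which lie in \<Omega>) at which the maximum of z \<bullet> d
   over z in \<Omega> is attained. *)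
definition max_extreme_points :: "'a::euclidean_space set \<Rightarrow> 'a \<Rightarrow> 'a set" where
  "max_extreme_points \<Omega> d = {x \<in> extreme_points \<Omega>. \<forall>z\<in>\<Omega>. z \<bullet> d \<le> x \<bullet> d}"

definition dual_family :: "'a::euclidean_space set set \<Rightarrow> 'a set set" where
  "dual_family \<R> =
     {convex hull (\<Union>\<Omega>\<in>\<R>. max_extreme_points \<Omega> d) | d. d \<in> sphere 0 1}"

end

theory Submission
  imports Defs
begin

text \<open>
  By (H1) the points of \<open>E\<close> are in convex position, so a polytope spanned by points of \<open>E\<close> is the
  same thing as the set \<open>A \<subseteq> E\<close> of its vertices, and dualisation becomes an operation on families of
  subsets of \<open>E\<close> (\<open>dual_family_convex_hull\<close>).  The whole argument takes place there.

  Let \<open>r\<close> be the minimal size of a member of the initial family.  A point \<open>x\<close> maximises \<open>d\<close> on some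
  member iff at least \<open>r\<close> points of \<open>E\<close> lie weakly below \<open>x\<close> in direction \<open>d\<close>: necessity holds
  because members have at least \<open>r\<close> points, sufficiency because all \<open>r\<close>-subsets are members.
  So the first dual consists of the upper sets \<open>G d\<close> obtained from \<open>E\<close> by cutting
  at the \<open>r\<close>-th smallest value of \<open>d\<close> (\<open>vertex_dual_eq_upper_ranks\<close>).

  It remains to see that dualising twice fixes this family, and in fact each direction separately:
  with \<open>H e\<close> the union over all \<open>d\<close> of the maximisers of \<open>e\<close> on \<open>G d\<close>, the union over all \<open>e\<close> of the
  maximisers of \<open>d\<close> on \<open>H e\<close> is again \<open>G d\<close>.  One inclusion is immediate, since every \<open>H e\<close> meets
  \<open>G d\<close>, which is upward closed.  For the other, given \<open>x \<in> G d\<close> one needs a direction \<open>e\<close> such that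
  \<open>x \<in> H e\<close> and nothing in \<open>H e\<close> lies above \<open>x\<close> in direction \<open>d\<close>.  If \<open>x\<close> realises the \<open>r\<close>-th largest
  value of \<open>e\<close>, then \<open>x \<in> H e\<close> and \<open>H e\<close> lies in the half-space where \<open>e\<close> is at least
  its value at \<open>x\<close> (\<open>second_dual_pivot\<close>).  If \<open>x\<close> lies on the cutting hyperplane of \<open>G d\<close>, then
  \<open>e = - d\<close> does it, and if \<open>x\<close> maximises \<open>d\<close> on \<open>E\<close>, then \<open>e = d\<close> does.  Otherwise choose, by (H1), a vector \<open>w\<close> for which \<open>x\<close> is the only maximiser on
  \<open>E\<close>, and rotate from \<open>- d\<close> towards \<open>w\<close>: the points above \<open>x\<close> in direction \<open>d\<close> stay behind \<open>x\<close> all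
  the time, while the points below it are overtaken one by one, so at some moment \<open>x\<close> has rank
  exactly \<open>r\<close> (\<open>exists_pivot_direction\<close>).
\<close>

section \<open>Families of vertex sets\<close>

definition maximizers :: "'a::real_inner set \<Rightarrow> 'a \<Rightarrow> 'a set" where
  "maximizers A d = {x \<in> A. \<forall>z\<in>A. z \<bullet> d \<le> x \<bullet> d}"

definition vertex_dual :: "'a::real_inner set set \<Rightarrow> 'a set set" where
  "vertex_dual \<A> = (\<lambda>d. \<Union>A\<in>\<A>. maximizers A d) ` sphere 0 1"

lemma maximizers_subset: "maximizers A d \<subseteq> A"
  by (auto simp: maximizers_def)

lemma finite_attains_max:
  fixes f :: "'a \<Rightarrow> 'b::linorder"
  assumes "finite A" "A \<noteq> {}"
  obtains m where "m \<in> A" "\<And>y. y \<in> A \<Longrightarrow> f y \<le> f m"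
proof -
  obtain m where m: "m \<in> A" "Max (f ` A) = f m"
    using obtains_MAX[OF assms] by blast
  have "f y \<le> f m" if "y \<in> A" for y
    using Max_ge[of "f ` A" "f y"] m that \<open>finite A\<close> by simp
  with m(1) show ?thesis by (rule that)
qed

lemma maximizers_nonempty:
  assumes "finite A" "A \<noteq> {}"
  shows "maximizers A d \<noteq> {}"
proof -
  obtain m where "m \<in> A" "\<And>y. y \<in> A \<Longrightarrow> y \<bullet> d \<le> m \<bullet> d"
    using finite_attains_max[OF assms, of "\<lambda>y. y \<bullet> d"] by blast
  then show ?thesis
    unfolding maximizers_def by blast
qed

lemma vertex_dual_subset_Pow: "\<A> \<subseteq> Pow E \<Longrightarrow> vertex_dual \<A> \<subseteq> Pow E"
  using maximizers_subset unfolding vertex_dual_def by blast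

lemma extreme_points_convex_hull_subset:
  fixes E :: "'a::euclidean_space set"
  assumes "finite E" and position: "\<And>x. x \<in> E \<Longrightarrow> x \<notin> convex hull (E - {x})" and "A \<subseteq> E"
  shows "extreme_points (convex hull A) = A"
proof
  show "extreme_points (convex hull A) \<subseteq> A"
    unfolding extreme_points_def by (rule extreme_points_of_convex_hull)
next
  show "A \<subseteq> extreme_points (convex hull A)"
  proof
    fix x assume "x \<in> A"
    have "A - {x} \<subseteq> E - {x}"
      using \<open>A \<subseteq> E\<close> by blast
    then have out: "x \<notin> convex hull (A - {x})"
      using position \<open>x \<in> A\<close> \<open>A \<subseteq> E\<close> hull_mono[of "A - {x}" "E - {x}" convex] by blast
    have "x extreme_point_of (convex hull (insert x (A - {x})))"
      using extreme_point_of_convex_hull_insert[of "A - {x}" x] out \<open>finite E\<close> \<open>A \<subseteq> E\<close>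
      by (meson finite_Diff finite_subset)
    then show "x \<in> extreme_points (convex hull A)"
      using \<open>x \<in> A\<close> by (simp add: extreme_points_def insert_absorb)
  qed
qed

lemma convex_hull_subset_Int:
  assumes position: "\<And>x. x \<in> E \<Longrightarrow> x \<notin> convex hull (E - {x})" and "A \<subseteq> E"
  shows "convex hull A \<inter> E = A"
proof
  show "convex hull A \<inter> E \<subseteq> A"
  proof
    fix x assume x: "x \<in> convex hull A \<inter> E"
    show "x \<in> A"
    proof (rule ccontr)
      assume "x \<notin> A"
      then have "A \<subseteq> E - {x}"
        using \<open>A \<subseteq> E\<close> by blast
      then have "x \<in> convex hull (E - {x})"
        using x hull_mono by blast
      with position x show False by blast
    qed
  qed
  show "A \<subseteq> convex hull A \<inter> E"
    using \<open>A \<subseteq> E\<close> hull_subset[of A convex] by blast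
qed

lemma max_extreme_points_convex_hull:
  fixes E :: "'a::euclidean_space set"
  assumes "finite E" and "\<And>x. x \<in> E \<Longrightarrow> x \<notin> convex hull (E - {x})" and "A \<subseteq> E"
  shows "max_extreme_points (convex hull A) d = maximizers A d"
proof -
  have "(\<forall>z\<in>convex hull A. z \<bullet> d \<le> c) \<longleftrightarrow> (\<forall>z\<in>A. z \<bullet> d \<le> c)" for c
  proof -
    have "convex {z. z \<bullet> d \<le> c}"
      using convex_halfspace_le[of d c] by (simp add: inner_commute)
    then have "convex hull A \<subseteq> {z. z \<bullet> d \<le> c} \<longleftrightarrow> A \<subseteq> {z. z \<bullet> d \<le> c}"
      by (meson hull_minimal hull_subset order_trans)
    then show ?thesis by blast
  qed
  then show ?thesis
    unfolding max_extreme_points_def maximizers_def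
    by (simp add: extreme_points_convex_hull_subset[OF assms])
qed

text \<open>Convex position makes the vertex set a faithful encoding of a polytope, and under this encoding
  the dual of a family of polytopes is the dual of the family of vertex sets.\<close>

lemma dual_family_convex_hull:
  fixes E :: "'a::euclidean_space set"
  assumes "finite E" and "\<And>x. x \<in> E \<Longrightarrow> x \<notin> convex hull (E - {x})" and "\<A> \<subseteq> Pow E"
  shows "dual_family ((hull) convex ` \<A>) = (hull) convex ` vertex_dual \<A>"
proof -
  have "(\<Union>\<Omega>\<in>(hull) convex ` \<A>. max_extreme_points \<Omega> d) = (\<Union>A\<in>\<A>. maximizers A d)" for d
  proof -
    have "max_extreme_points (convex hull A) d = maximizers A d" if "A \<in> \<A>" for A
      using max_extreme_points_convex_hull[OF assms(1,2)] \<open>\<A> \<subseteq> Pow E\<close> that by blast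
    then show ?thesis by simp
  qed
  then show ?thesis
    unfolding dual_family_def vertex_dual_def by auto
qed

section \<open>The first dual: cutting at the rank\<close>

definition upper_ranks :: "'a::real_inner set \<Rightarrow> nat \<Rightarrow> 'a \<Rightarrow> 'a set" where
  "upper_ranks E r d = {x \<in> E. r \<le> card {y \<in> E. y \<bullet> d \<le> x \<bullet> d}}"

lemma upper_ranks_subset: "upper_ranks E r d \<subseteq> E"
  by (auto simp: upper_ranks_def)

lemma upper_ranks_upward:
  assumes "finite E" "x \<in> upper_ranks E r d" "y \<in> E" "x \<bullet> d \<le> y \<bullet> d"
  shows "y \<in> upper_ranks E r d"
proof -
  have "card {z \<in> E. z \<bullet> d \<le> x \<bullet> d} \<le> card {z \<in> E. z \<bullet> d \<le> y \<bullet> d}"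
    using assms by (intro card_mono) auto
  then show ?thesis
    using assms by (auto simp: upper_ranks_def)
qed

text \<open>The omitted points all lie weakly below the highest omitted one, which by definition has fewer
  than \<open>r\<close> points weakly below it.\<close>

lemma card_Diff_upper_ranks:
  assumes "finite E" "0 < r"
  shows "card (E - upper_ranks E r d) < r"
proof (cases "E - upper_ranks E r d = {}")
  case True
  then show ?thesis using \<open>0 < r\<close> by (simp only: card.empty)
next
  case False
  then obtain m where m: "m \<in> maximizers (E - upper_ranks E r d) d"
    using maximizers_nonempty[of "E - upper_ranks E r d" d] \<open>finite E\<close> by blast
  then have "E - upper_ranks E r d \<subseteq> {y \<in> E. y \<bullet> d \<le> m \<bullet> d}"
    by (auto simp: maximizers_def)
  then have "card (E - upper_ranks E r d) \<le> card {y \<in> E. y \<bullet> d \<le> m \<bullet> d}"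
    using \<open>finite E\<close> by (intro card_mono) auto
  also have "\<dots> < r"
    using m by (auto simp: maximizers_def upper_ranks_def)
  finally show ?thesis .
qed

lemma upper_ranks_meets:
  assumes "finite E" "0 < r" "B \<subseteq> E" "r \<le> card B"
  shows "upper_ranks E r d \<inter> B \<noteq> {}"
proof
  assume "upper_ranks E r d \<inter> B = {}"
  then have "card B \<le> card (E - upper_ranks E r d)"
    using assms by (intro card_mono) auto
  then show False
    using card_Diff_upper_ranks[OF assms(1,2), of d] \<open>r \<le> card B\<close> by linarith
qed

lemma vertex_dual_eq_upper_ranks:
  fixes E :: "'a::real_inner set"
  assumes "finite E" "0 < r" "\<A> \<subseteq> Pow E"
    and large: "\<And>A. A \<in> \<A> \<Longrightarrow> r \<le> card A"
    and all: "\<And>A. A \<subseteq> E \<Longrightarrow> card A = r \<Longrightarrow> A \<in> \<A>"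
  shows "vertex_dual \<A> = upper_ranks E r ` sphere 0 1"
proof -
  have "(\<Union>A\<in>\<A>. maximizers A d) = upper_ranks E r d" for d
  proof
    show "(\<Union>A\<in>\<A>. maximizers A d) \<subseteq> upper_ranks E r d"
    proof
      fix x assume "x \<in> (\<Union>A\<in>\<A>. maximizers A d)"
      then obtain A where A: "A \<in> \<A>" "x \<in> maximizers A d" by blast
      then have "A \<subseteq> {y \<in> E. y \<bullet> d \<le> x \<bullet> d}"
        using \<open>\<A> \<subseteq> Pow E\<close> by (auto simp: maximizers_def)
      then have "card A \<le> card {y \<in> E. y \<bullet> d \<le> x \<bullet> d}"
        using \<open>finite E\<close> by (intro card_mono) auto
      then show "x \<in> upper_ranks E r d"
        using A large[of A] \<open>\<A> \<subseteq> Pow E\<close> by (auto simp: upper_ranks_def maximizers_def)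
    qed
    show "upper_ranks E r d \<subseteq> (\<Union>A\<in>\<A>. maximizers A d)"
    proof
      fix x assume "x \<in> upper_ranks E r d"
      then have "x \<in> E" and rank: "r \<le> card {y \<in> E. y \<bullet> d \<le> x \<bullet> d}"
        by (auto simp: upper_ranks_def)
      then obtain A where A: "{x} \<subseteq> A" "A \<subseteq> {y \<in> E. y \<bullet> d \<le> x \<bullet> d}" "card A = r"
        using exists_subset_between[of "{x}" r "{y \<in> E. y \<bullet> d \<le> x \<bullet> d}"] \<open>finite E\<close> \<open>0 < r\<close>
        by auto
      then have "A \<in> \<A>" "x \<in> maximizers A d"
        using all[of A] by (auto simp: maximizers_def)
      then show "x \<in> (\<Union>A\<in>\<A>. maximizers A d)" by blast
    qed
  qed
  then show ?thesis
    unfolding vertex_dual_def by simp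
qed

section \<open>Dualising twice more\<close>

definition second_dual :: "'a::real_inner set \<Rightarrow> nat \<Rightarrow> 'a \<Rightarrow> 'a set" where
  "second_dual E r e = (\<Union>d\<in>sphere 0 1. maximizers (upper_ranks E r d) e)"

lemma second_dual_subset: "second_dual E r e \<subseteq> E"
  unfolding second_dual_def using maximizers_subset upper_ranks_subset by fast

text \<open>The hypotheses say that \<open>x\<close> realises the \<open>r\<close>-th largest value of \<open>e\<close> on \<open>E\<close>.  Then \<open>x\<close> is the
  top of the upper set for \<open>- e\<close>.  On the other hand all upper sets omit fewer than \<open>r\<close> points, so
  each contains one of the at least \<open>r\<close> points where \<open>e\<close> is at least its value at \<open>x\<close>.\<close>

lemma second_dual_pivot:
  assumes "finite E" "0 < r" "x \<in> E" "e \<in> sphere 0 1"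
    and above: "card {y \<in> E. x \<bullet> e < y \<bullet> e} < r"
    and weakly_above: "r \<le> card {y \<in> E. x \<bullet> e \<le> y \<bullet> e}"
  shows "x \<in> second_dual E r e" and "second_dual E r e \<subseteq> {y. x \<bullet> e \<le> y \<bullet> e}"
proof -
  have "z \<bullet> e \<le> x \<bullet> e" if z: "z \<in> upper_ranks E r (- e)" for z
  proof (rule ccontr)
    assume "\<not> z \<bullet> e \<le> x \<bullet> e"
    then have "card {y \<in> E. z \<bullet> e \<le> y \<bullet> e} \<le> card {y \<in> E. x \<bullet> e < y \<bullet> e}"
      using \<open>finite E\<close> by (intro card_mono) auto
    then show False
      using z above by (simp add: upper_ranks_def)
  qed
  moreover have "x \<in> upper_ranks E r (- e)"
    using \<open>x \<in> E\<close> weakly_above by (simp add: upper_ranks_def)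
  ultimately have "x \<in> maximizers (upper_ranks E r (- e)) e"
    by (auto simp: maximizers_def)
  then show "x \<in> second_dual E r e"
    unfolding second_dual_def using \<open>e \<in> sphere 0 1\<close> by (intro UN_I[of "- e"]) auto
next
  show "second_dual E r e \<subseteq> {y. x \<bullet> e \<le> y \<bullet> e}"
  proof
    fix y assume "y \<in> second_dual E r e"
    then obtain d where y: "y \<in> maximizers (upper_ranks E r d) e"
      by (auto simp: second_dual_def)
    have "upper_ranks E r d \<inter> {y \<in> E. x \<bullet> e \<le> y \<bullet> e} \<noteq> {}"
      using assms by (intro upper_ranks_meets) auto
    then obtain z where "z \<in> upper_ranks E r d" "x \<bullet> e \<le> z \<bullet> e" by blast
    with y show "y \<in> {y. x \<bullet> e \<le> y \<bullet> e}"
      by (force simp: maximizers_def)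
  qed
qed

text \<open>An element realising the \<open>r\<close>-th smallest value of \<open>f\<close>: the lowest among those having at least
  \<open>r\<close> elements weakly below them.\<close>

lemma exists_rank_element:
  fixes f :: "'a \<Rightarrow> real"
  assumes "finite B" "0 < r" "r \<le> card B"
  obtains b where "b \<in> B" "card {y \<in> B. f y < f b} < r" "r \<le> card {y \<in> B. f y \<le> f b}"
proof -
  define C where "C = {b \<in> B. r \<le> card {y \<in> B. f y \<le> f b}}"
  have "B \<noteq> {}" "finite C"
    using assms by (auto simp: C_def)
  obtain m where m: "m \<in> B" "\<And>y. y \<in> B \<Longrightarrow> f y \<le> f m"
    using finite_attains_max[OF \<open>finite B\<close> \<open>B \<noteq> {}\<close>, of f] by blast
  then have "{y \<in> B. f y \<le> f m} = B" by auto
  then have "m \<in> C"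
    using m \<open>r \<le> card B\<close> by (simp add: C_def)
  then obtain b where b: "b \<in> C" "\<And>c. c \<in> C \<Longrightarrow> f b \<le> f c"
    using arg_min_if_finite(1)[of C f] arg_min_least[of C _ f] \<open>finite C\<close> by blast
  have "card {y \<in> B. f y < f b} < r"
  proof (rule ccontr)
    assume large: "\<not> card {y \<in> B. f y < f b} < r"
    define L where "L = {y \<in> B. f y < f b}"
    have "finite L"
      using \<open>finite B\<close> by (simp add: L_def)
    moreover have "L \<noteq> {}"
      using large \<open>0 < r\<close> unfolding L_def by (metis card.empty)
    ultimately obtain c where c: "c \<in> L" "\<And>y. y \<in> L \<Longrightarrow> f y \<le> f c"
      using finite_attains_max[of L f] by blast
    have "card L \<le> card {y \<in> B. f y \<le> f c}"
      using c \<open>finite B\<close> by (intro card_mono) (auto simp: L_def)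
    then have "c \<in> C"
      using c large by (auto simp: L_def C_def)
    with b(2)[of c] c show False
      by (auto simp: L_def)
  qed
  then show ?thesis
    using that b by (auto simp: C_def)
qed

text \<open>This is where convex position enters a second time.  Rotating from \<open>- d\<close> to a direction
  \<open>w\<close> exposing \<open>x\<close> runs through the directions \<open>w - t *\<^sub>R d\<close> with \<open>t\<close> decreasing to \<open>0\<close>.  A point \<open>y\<close>
  not below \<open>x\<close> in direction \<open>d\<close> never catches up with \<open>x\<close>; a point \<open>y\<close> below it is weakly ahead of
  \<open>x\<close> exactly as long as \<open>t\<close> is at least a positive slope depending on \<open>y\<close>.  Stopping at the \<open>r\<close>-th
  smallest slope gives \<open>x\<close> rank \<open>r\<close>.  Since the point \<open>u\<close> is strictly behind \<open>x\<close>, the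
  direction reached is nonzero and can be normalised.\<close>

lemma exists_pivot_direction:
  fixes E :: "'a::euclidean_space set"
  assumes "finite E" "0 < r" "x \<in> E" and exposed: "x \<notin> convex hull (E - {x})"
    and below: "r \<le> card {y \<in> E. y \<bullet> d < x \<bullet> d}"
    and "u \<in> E" "x \<bullet> d < u \<bullet> d"
  obtains e where "e \<in> sphere 0 1" "card {y \<in> E. x \<bullet> e < y \<bullet> e} < r"
    "r \<le> card {y \<in> E. x \<bullet> e \<le> y \<bullet> e}" "\<And>y. y \<in> E \<Longrightarrow> x \<bullet> e \<le> y \<bullet> e \<Longrightarrow> y \<bullet> d \<le> x \<bullet> d"
proof -
  have "closed (convex hull (E - {x}))"
    using \<open>finite E\<close> by (intro compact_imp_closed finite_imp_compact_convex_hull) auto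
  then obtain a b where ab: "a \<bullet> x < b" "\<And>y. y \<in> convex hull (E - {x}) \<Longrightarrow> b < a \<bullet> y"
    using separating_hyperplane_closed_point[of "convex hull (E - {x})" x] exposed by auto
  define w where "w = - a"
  have w: "y \<bullet> w < x \<bullet> w" if "y \<in> E" "y \<noteq> x" for y
    using ab(1) ab(2)[of y] that hull_inc[of y "E - {x}" convex]
    by (simp add: w_def inner_commute)
  define B where "B = {y \<in> E. y \<bullet> d < x \<bullet> d}"
  define slope where "slope y = ((x - y) \<bullet> w) / ((x - y) \<bullet> d)" for y
  obtain c where c: "c \<in> B" "card {y \<in> B. slope y < slope c} < r"
      "r \<le> card {y \<in> B. slope y \<le> slope c}"
    using exists_rank_element[of B r slope] \<open>finite E\<close> \<open>0 < r\<close> below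
    by (auto simp: B_def)
  define t where "t = slope c"
  define v where "v = w - t *\<^sub>R d"
  have "0 < (x - c) \<bullet> d" "0 < (x - c) \<bullet> w"
    using c(1) w[of c] by (auto simp: B_def inner_diff_left)
  then have "0 < t"
    by (simp add: t_def slope_def)
  have behind: "y \<bullet> v < x \<bullet> v" if "y \<in> E" "y \<notin> B" "y \<noteq> x" for y
  proof -
    have "t * (x \<bullet> d) \<le> t * (y \<bullet> d)"
      using that \<open>0 < t\<close> by (intro mult_left_mono) (auto simp: B_def)
    then show ?thesis
      using w[of y] that by (simp add: v_def inner_diff_right)
  qed
  have ahead: "x \<bullet> v \<le> y \<bullet> v \<longleftrightarrow> slope y \<le> t" "x \<bullet> v < y \<bullet> v \<longleftrightarrow> slope y < t" if "y \<in> B" for y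
  proof -
    have "0 < (x - y) \<bullet> d"
      using that by (simp add: B_def inner_diff_left)
    then have "slope y \<le> t \<longleftrightarrow> (x - y) \<bullet> w \<le> t * ((x - y) \<bullet> d)"
      "slope y < t \<longleftrightarrow> (x - y) \<bullet> w < t * ((x - y) \<bullet> d)"
      by (simp_all add: slope_def pos_divide_le_eq pos_divide_less_eq)
    then show "x \<bullet> v \<le> y \<bullet> v \<longleftrightarrow> slope y \<le> t" "x \<bullet> v < y \<bullet> v \<longleftrightarrow> slope y < t"
      by (auto simp: v_def inner_diff_right inner_diff_left right_diff_distrib)
  qed
  have "{y \<in> E. x \<bullet> v < y \<bullet> v} = {y \<in> B. slope y < t}"
    using behind ahead(2) by (force simp: B_def)
  then have less: "card {y \<in> E. x \<bullet> v < y \<bullet> v} < r"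
    using c by (simp add: t_def)
  have "{y \<in> B. slope y \<le> t} \<subseteq> {y \<in> E. x \<bullet> v \<le> y \<bullet> v}"
    using ahead(1) by (auto simp: B_def)
  then have "card {y \<in> B. slope y \<le> t} \<le> card {y \<in> E. x \<bullet> v \<le> y \<bullet> v}"
    using \<open>finite E\<close> by (intro card_mono) auto
  then have ge: "r \<le> card {y \<in> E. x \<bullet> v \<le> y \<bullet> v}"
    using c by (simp add: t_def)
  have half: "y \<bullet> d \<le> x \<bullet> d" if "y \<in> E" "x \<bullet> v \<le> y \<bullet> v" for y
    using behind[of y] that by (force simp: B_def)
  have "u \<bullet> v < x \<bullet> v"
    using behind[of u] assms by (auto simp: B_def)
  then have "v \<noteq> 0" by auto
  define e where "e = v /\<^sub>R norm v"
  have e: "x \<bullet> e \<le> y \<bullet> e \<longleftrightarrow> x \<bullet> v \<le> y \<bullet> v" "x \<bullet> e < y \<bullet> e \<longleftrightarrow> x \<bullet> v < y \<bullet> v" for y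
    using \<open>v \<noteq> 0\<close> by (simp_all add: e_def)
  have "e \<in> sphere 0 1"
    using \<open>v \<noteq> 0\<close> by (simp add: e_def)
  then show ?thesis
    using that[of e] less ge half unfolding e by blast
qed

text \<open>Three positions of \<open>x\<close> in the upper set are distinguished for the inclusion from right to left:
  at the cut, where the opposite direction works; at the top, where \<open>d\<close> itself works because \<open>x\<close> then
  maximises \<open>d\<close> on all of \<open>E\<close>; and strictly in between, where a rotation is needed.  The top is kept
  apart because there the rotation from \<open>- d\<close> could pass through the zero vector, namely when the
  exposing direction is \<open>d\<close> itself.\<close>

lemma third_dual_eq_upper_ranks:
  fixes E :: "'a::euclidean_space set"
  assumes "finite E" "0 < r" "r \<le> card E" and d: "d \<in> sphere 0 1"
    and position: "\<And>x. x \<in> E \<Longrightarrow> x \<notin> convex hull (E - {x})"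
  shows "(\<Union>e\<in>sphere 0 1. maximizers (second_dual E r e) d) = upper_ranks E r d"
proof
  show "(\<Union>e\<in>sphere 0 1. maximizers (second_dual E r e) d) \<subseteq> upper_ranks E r d"
  proof
    fix x assume "x \<in> (\<Union>e\<in>sphere 0 1. maximizers (second_dual E r e) d)"
    then obtain e where x: "x \<in> maximizers (second_dual E r e) d" by blast
    have "upper_ranks E r d \<noteq> {}"
      using upper_ranks_meets[of E r E d] assms(1-3) by auto
    moreover have "finite (upper_ranks E r d)"
      using upper_ranks_subset \<open>finite E\<close> by (rule finite_subset)
    ultimately obtain y where y: "y \<in> maximizers (upper_ranks E r d) e"
      using maximizers_nonempty by blast
    then have "y \<in> second_dual E r e"
      using d by (auto simp: second_dual_def)
    then have "y \<bullet> d \<le> x \<bullet> d"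
      using x by (auto simp: maximizers_def)
    moreover have "x \<in> E"
      using x maximizers_subset second_dual_subset by blast
    ultimately show "x \<in> upper_ranks E r d"
      using upper_ranks_upward[OF \<open>finite E\<close>] y maximizers_subset by blast
  qed
next
  show "upper_ranks E r d \<subseteq> (\<Union>e\<in>sphere 0 1. maximizers (second_dual E r e) d)"
  proof
    fix x assume x: "x \<in> upper_ranks E r d"
    then have "x \<in> E" by (simp add: upper_ranks_def)
    have "\<exists>e\<in>sphere 0 1. x \<in> second_dual E r e \<and> (\<forall>y\<in>second_dual E r e. y \<bullet> d \<le> x \<bullet> d)"
    proof (cases "card {y \<in> E. y \<bullet> d < x \<bullet> d} < r")
      case True
      then have "card {y \<in> E. x \<bullet> (- d) < y \<bullet> (- d)} < r"
        "r \<le> card {y \<in> E. x \<bullet> (- d) \<le> y \<bullet> (- d)}"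
        using x by (simp_all add: upper_ranks_def)
      then have "x \<in> second_dual E r (- d)" "second_dual E r (- d) \<subseteq> {y. x \<bullet> (- d) \<le> y \<bullet> (- d)}"
        using second_dual_pivot[OF assms(1,2) \<open>x \<in> E\<close>, of "- d"] d by simp_all
      then show ?thesis
        using d by (intro bexI[of _ "- d"]) auto
    next
      case below: False
      show ?thesis
      proof (cases "\<exists>u\<in>E. x \<bullet> d < u \<bullet> d")
        case True
        then obtain u where u: "u \<in> E" "x \<bullet> d < u \<bullet> d" by blast
        have rank: "r \<le> card {y \<in> E. y \<bullet> d < x \<bullet> d}"
          using below by simp
        obtain e where e: "e \<in> sphere 0 1" "card {y \<in> E. x \<bullet> e < y \<bullet> e} < r"
            "r \<le> card {y \<in> E. x \<bullet> e \<le> y \<bullet> e}" "\<And>y. y \<in> E \<Longrightarrow> x \<bullet> e \<le> y \<bullet> e \<Longrightarrow> y \<bullet> d \<le> x \<bullet> d"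
          using exists_pivot_direction[OF assms(1,2) \<open>x \<in> E\<close> position[OF \<open>x \<in> E\<close>] rank u] by blast
        from e(1-3) have "x \<in> second_dual E r e" "second_dual E r e \<subseteq> {y. x \<bullet> e \<le> y \<bullet> e}"
          using second_dual_pivot[OF assms(1,2) \<open>x \<in> E\<close>, of e] by blast+
        then show ?thesis
          using e(1,4) second_dual_subset by blast
      next
        case False
        then have top: "y \<bullet> d \<le> x \<bullet> d" if "y \<in> E" for y
          using that by force
        then have "x \<in> maximizers (upper_ranks E r d) d"
          using x by (auto simp: maximizers_def upper_ranks_def)
        then have "x \<in> second_dual E r d"
          using d by (auto simp: second_dual_def)
        then show ?thesis
          using top d second_dual_subset by blast
      qed
    qed
    then show "x \<in> (\<Union>e\<in>sphere 0 1. maximizers (second_dual E r e) d)"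
      by (auto simp: maximizers_def)
  qed
qed

lemma vertex_dual_vertex_dual_upper_ranks:
  fixes E :: "'a::euclidean_space set"
  assumes "finite E" "0 < r" "r \<le> card E" "\<And>x. x \<in> E \<Longrightarrow> x \<notin> convex hull (E - {x})"
  shows "vertex_dual (vertex_dual (upper_ranks E r ` sphere 0 1)) = upper_ranks E r ` sphere 0 1"
proof -
  have "vertex_dual (upper_ranks E r ` sphere 0 1) = second_dual E r ` sphere 0 1"
    by (simp add: vertex_dual_def second_dual_def)
  then have "vertex_dual (vertex_dual (upper_ranks E r ` sphere 0 1))
      = (\<lambda>d. \<Union>e\<in>sphere 0 1. maximizers (second_dual E r e) d) ` sphere 0 1"
    by (simp add: vertex_dual_def)
  also have "\<dots> = upper_ranks E r ` sphere 0 1"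
    using third_dual_eq_upper_ranks[OF assms(1-3) _ assms(4)] by (intro image_cong) auto
  finally show ?thesis .
qed

section \<open>The period of the dualisation\<close>

theorem theorem1p2:
  fixes \<R> :: "nat \<Rightarrow> (real ^ 'n) set set"
    and E :: "(real ^ 'n) set"
    and r_min :: nat
  assumes "finite (\<R> 0)" and "\<R> 0 \<noteq> {}"
    and "\<And>\<Omega>. \<Omega> \<in> \<R> 0 \<Longrightarrow> nonempty_polytope \<Omega>"
    and "\<And>n. \<R> (n + 1) = dual_family (\<R> n)"
    and "E = (\<Union>\<Omega>\<in>\<R> 0. extreme_points \<Omega>)"
    and "r_min = Min ((\<lambda>\<Omega>. card (\<Omega> \<inter> E)) ` \<R> 0)"
    and H1: "\<And>x. x \<in> E \<Longrightarrow> x \<notin> convex hull (E - {x})"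
    and H2: "\<And>A. A \<subseteq> E \<Longrightarrow> card A = r_min \<Longrightarrow> convex hull A \<in> \<R> 0"
  shows "\<R> 1 = \<R> 3"
proof -
  note polytopes = assms(3) and step = assms(4) and E_def = assms(5) and r_min_def = assms(6)
  have "finite E"
    unfolding E_def using assms(1)
  proof (rule finite_UN_I)
    fix \<Omega> assume "\<Omega> \<in> \<R> 0"
    then show "finite (extreme_points \<Omega>)"
      using polytopes[of \<Omega>] unfolding nonempty_polytope_iff by blast
  qed
  define \<A> where "\<A> = extreme_points ` \<R> 0"
  have "\<A> \<subseteq> Pow E"
    unfolding \<A>_def E_def by blast
  have hull_extreme: "convex hull (extreme_points \<Omega>) = \<Omega>" if "\<Omega> \<in> \<R> 0" for \<Omega>
    using polytopes[OF that] Krein_Milman_Minkowski[of \<Omega>]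
    by (simp add: nonempty_polytope_iff extreme_points_def)
  then have R0: "\<R> 0 = (hull) convex ` \<A>"
    by (force simp: \<A>_def)
  have Int_E: "\<Omega> \<inter> E = extreme_points \<Omega>" if "\<Omega> \<in> \<R> 0" for \<Omega>
    using convex_hull_subset_Int[OF H1, of "extreme_points \<Omega>"] hull_extreme[OF that] that
    by (auto simp: E_def)
  have large: "r_min \<le> card A" if "A \<in> \<A>" for A
    using that Int_E assms(1) by (auto simp: \<A>_def r_min_def intro!: Min_le)
  have all: "A \<in> \<A>" if "A \<subseteq> E" "card A = r_min" for A
    using H2[OF that] extreme_points_convex_hull_subset[OF \<open>finite E\<close> H1 that(1)]
    by (force simp: \<A>_def)
  have "r_min \<in> (\<lambda>\<Omega>. card (\<Omega> \<inter> E)) ` \<R> 0"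
    unfolding r_min_def using assms(1,2) by (intro Min_in) auto
  then obtain \<Omega> where \<Omega>: "\<Omega> \<in> \<R> 0" "r_min = card (\<Omega> \<inter> E)" by blast
  have "extreme_points \<Omega> \<noteq> {}"
    using hull_extreme[OF \<Omega>(1)] polytopes[OF \<Omega>(1)] by (force simp: nonempty_polytope_def)
  then have "0 < r_min"
    using \<Omega> Int_E[OF \<Omega>(1)] \<open>finite E\<close> by (metis card_gt_0_iff finite_Int)
  have "r_min \<le> card E"
    using \<Omega>(2) \<open>finite E\<close> by (simp add: card_mono)
  note dual = dual_family_convex_hull[OF \<open>finite E\<close> H1]
  have R1: "\<R> 1 = (hull) convex ` vertex_dual \<A>"
    using step[of 0] dual[OF _ \<open>\<A> \<subseteq> Pow E\<close>] R0 by simp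
  have R2: "\<R> 2 = (hull) convex ` vertex_dual (vertex_dual \<A>)"
    using step[of 1] dual[of "vertex_dual \<A>"] R1 vertex_dual_subset_Pow[OF \<open>\<A> \<subseteq> Pow E\<close>]
    by (simp add: numeral_2_eq_2)
  have R3: "\<R> 3 = (hull) convex ` vertex_dual (vertex_dual (vertex_dual \<A>))"
    using step[of 2] dual[of "vertex_dual (vertex_dual \<A>)"] R2
      vertex_dual_subset_Pow[OF vertex_dual_subset_Pow[OF \<open>\<A> \<subseteq> Pow E\<close>]]
    by simp
  have "vertex_dual \<A> = upper_ranks E r_min ` sphere 0 1"
    using \<open>finite E\<close> \<open>0 < r_min\<close> \<open>\<A> \<subseteq> Pow E\<close> large all by (rule vertex_dual_eq_upper_ranks)
  then have "vertex_dual (vertex_dual (vertex_dual \<A>)) = vertex_dual \<A>"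
    using vertex_dual_vertex_dual_upper_ranks[OF \<open>finite E\<close> \<open>0 < r_min\<close> \<open>r_min \<le> card E\<close> H1]
    by simp
  then show ?thesis
    using R1 R3 by simp
qed

end
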